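(* Let $n$ be a positive integer. Then there is no binary isolation of the unary lattice $\langle n\rangle$; that is, there is no positive definite binary $\mathbb{Z}$-lattice $L$ with $\mathfrak{s}L\subseteq\mathbb{Z}$ which represents $nk^2$ for every integer $k\ge 2$ but does not represent $n$.
   Context: A $\mathbb{Z}$-lattice is a free $\mathbb{Z}$-module with a positive definite symmetric bilinear form $B$ (rational values), $Q(x)=B(x,x)$; its scale ideal $\mathfrak{s}L$ is the $\mathbb{Z}$-module generated by all $B(x,y)$, $x,y\in L$. $\langle n\rangle$ denotes the rank one lattice $\mathbb{Z}e$ with $Q(e)=n$; its proper sublattices are $\langle nk^2\rangle$, $k\ge2$. An isolation of a lattice $\ell$ is a $\mathbb{Z}$-lattice $L$ with $\mathfrak{s}L\subseteq\mathbb{Z}$ that represents every proper sublattice (sublattice of the same rank and index $>1$) of $\ell$ but does not represent $\ell$. An integer $m$ is represented by $L$ if $Q(x)=m$ for some $x\in L$. *)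

theory Defs
  imports Complex_Main
begin

definition int_scale :: "int \<Rightarrow> 'a::ab_group_add \<Rightarrow> 'a" where
  "int_scale k x = (\<Sum>i<nat k. x) - (\<Sum>i<nat (- k). x)"

lemma sum_const_add:
  fixes x :: "'a::ab_group_add" and m p :: nat
  shows "(\<Sum>i<m + p. x) = (\<Sum>i<m. x) + (\<Sum>i<p. x)"
  by (induction p) (simp_all add: algebra_simps)

lemma sum_const_mult:
  fixes x :: "'a::ab_group_add" and m p :: nat
  shows "(\<Sum>i<m * p. x) = (\<Sum>i<m. \<Sum>j<p. x)"
  by (induction m) (simp_all add: sum_const_add algebra_simps)

lemma int_scale_diff_nat:
  "int_scale (int m - int p) x = (\<Sum>i<m. x) - (\<Sum>i<p. x)"
proof (cases "p \<le> m")
  case True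
  then obtain d where "m = p + d" using le_Suc_ex by blast
  then show ?thesis by (simp add: int_scale_def sum_const_add)
next
  case False
  then obtain d where "p = m + d" using le_Suc_ex nat_le_linear by blast
  then show ?thesis by (simp add: int_scale_def sum_const_add)
qed

interpretation int_module: module "int_scale :: int \<Rightarrow> 'a::ab_group_add \<Rightarrow> 'a"
proof
  fix a b :: int and x y :: 'a
  obtain m p where a: "a = int m - int p" using int_diff_cases by blast
  obtain m' p' where b: "b = int m' - int p'" using int_diff_cases by blast
  show "int_scale a (x + y) = int_scale a x + int_scale a y"
    unfolding a int_scale_diff_nat by (simp add: sum.distrib)
  have ab: "a + b = int (m + m') - int (p + p')" by (simp add: a b)
  show "int_scale (a + b) x = int_scale a x + int_scale b x"
    unfolding ab int_scale_diff_nat unfolding a b int_scale_diff_nat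
    by (simp add: sum_const_add)
  have ab: "a * b = int (m * m' + p * p') - int (m * p' + p * m')"
    by (simp add: a b algebra_simps)
  show "int_scale a (int_scale b x) = int_scale (a * b) x"
    unfolding ab int_scale_diff_nat unfolding a b int_scale_diff_nat
    by (simp add: sum_const_add sum_const_mult sum_subtractf)
  show "int_scale 1 x = x"
    by (simp add: int_scale_def)
qed

lemma int_scale_ring: "int_scale k (x :: 'a::ring_1) = of_int k * x"
  unfolding int_scale_def by (cases "k \<ge> 0") (simp_all add: of_nat_nat)

record 'a zlat =
  points :: "'a set"
  form :: "'a \<Rightarrow> 'a \<Rightarrow> rat"

definition has_rank :: "'a::ab_group_add zlat \<Rightarrow> nat \<Rightarrow> bool" where
  "has_rank L r \<longleftrightarrow>
     (\<exists>b. finite b \<and> card b = r \<and> int_module.independent b \<and> int_module.span b = points L)"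

definition bilinear_form :: "'a::ab_group_add zlat \<Rightarrow> bool" where
  "bilinear_form L \<longleftrightarrow>
     (\<forall>x\<in>points L. \<forall>y\<in>points L. \<forall>z\<in>points L.
        form L (x + y) z = form L x z + form L y z \<and>
        form L z (x + y) = form L z x + form L z y) \<and>
     (\<forall>k. \<forall>x\<in>points L. \<forall>z\<in>points L.
        form L (int_scale k x) z = of_int k * form L x z \<and>
        form L z (int_scale k x) = of_int k * form L z x)"

definition symmetric_form :: "'a zlat \<Rightarrow> bool" where
  "symmetric_form L \<longleftrightarrow> (\<forall>x\<in>points L. \<forall>y\<in>points L. form L x y = form L y x)"

definition positive_definite :: "'a::ab_group_add zlat \<Rightarrow> bool" where
  "positive_definite L \<longleftrightarrow> (\<forall>x\<in>points L. x \<noteq> 0 \<longrightarrow> form L x x > 0)"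

definition zlattice :: "'a::ab_group_add zlat \<Rightarrow> bool" where
  "zlattice L \<longleftrightarrow>
     (\<exists>r. has_rank L r) \<and> bilinear_form L \<and> symmetric_form L \<and> positive_definite L"

abbreviation qform :: "'a zlat \<Rightarrow> 'a \<Rightarrow> rat" where
  "qform L x \<equiv> form L x x"

definition scale_ideal :: "'a zlat \<Rightarrow> rat set" where
  "scale_ideal L = int_module.span {form L x y |x y. x \<in> points L \<and> y \<in> points L}"

definition represents :: "'a::ab_group_add zlat \<Rightarrow> 'b::ab_group_add zlat \<Rightarrow> bool" where
  "represents L K \<longleftrightarrow>
     (\<exists>\<sigma>. (\<forall>x\<in>points K. \<sigma> x \<in> points L) \<and>
          (\<forall>x\<in>points K. \<forall>y\<in>points K. \<sigma> (x + y) = \<sigma> x + \<sigma> y) \<and>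
          (\<forall>k. \<forall>x\<in>points K. \<sigma> (int_scale k x) = int_scale k (\<sigma> x)) \<and>
          (\<forall>x\<in>points K. \<forall>y\<in>points K. form L (\<sigma> x) (\<sigma> y) = form K x y))"

definition represents_int :: "'a zlat \<Rightarrow> int \<Rightarrow> bool" where
  "represents_int L m \<longleftrightarrow> (\<exists>x\<in>points L. qform L x = of_int m)"

definition sublattice :: "'a::ab_group_add zlat \<Rightarrow> 'a zlat \<Rightarrow> bool" where
  "sublattice K L \<longleftrightarrow> zlattice K \<and> points K \<subseteq> points L \<and>
     (\<forall>x\<in>points K. \<forall>y\<in>points K. form K x y = form L x y)"

definition lattice_index :: "'a::ab_group_add zlat \<Rightarrow> 'a zlat \<Rightarrow> nat" where
  "lattice_index L K = card {(+) x ` points K |x. x \<in> points L}"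

text \<open>The index is finite because the ranks agree, so the convention that \<open>card\<close> is 0 on
  infinite sets plays no role here.\<close>
definition proper_sublattice :: "'a::ab_group_add zlat \<Rightarrow> 'a zlat \<Rightarrow> bool" where
  "proper_sublattice K L \<longleftrightarrow>
     sublattice K L \<and> (\<exists>r. has_rank K r \<and> has_rank L r) \<and> lattice_index L K > 1"

definition isolation :: "'a::ab_group_add zlat \<Rightarrow> 'b::ab_group_add zlat \<Rightarrow> bool" where
  "isolation L l \<longleftrightarrow> zlattice L \<and> scale_ideal L \<subseteq> \<int> \<and>
     (\<forall>K. proper_sublattice K l \<longrightarrow> represents L K) \<and> \<not> represents L l"

definition unary :: "int \<Rightarrow> int zlat" where
  "unary n = \<lparr>points = UNIV, form = (\<lambda>x y. of_int (n * x * y))\<rparr>"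

lemma has_rank_unary: "has_rank (unary n) 1"
  unfolding has_rank_def
proof (intro exI conjI)
  show "int_module.independent {1::int}"
    by (auto simp: int_module.dependent_explicit int_scale_ring subset_singleton_iff)
  show "int_module.span {1::int} = points (unary n)"
    by (auto simp: unary_def int_module.span_singleton int_scale_ring)
qed simp_all

lemma zlattice_unary: "n > 0 \<Longrightarrow> zlattice (unary n)"
  unfolding zlattice_def bilinear_form_def symmetric_form_def positive_definite_def
  using has_rank_unary[of n]
  by (auto simp: unary_def int_scale_ring algebra_simps zero_less_mult_iff mult_less_0_iff
      simp flip: of_int_mult)

end

theory Submission imports Defs "HOL-Number_Theory.Residues"
begin

text \<open>
  Let \<open>d = ac - b\<^sup>2 > 0\<close> be the discriminant of \<open>L\<close>. As \<open>4d - 1\<close> is congruent to 3 modulo 4, it has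
  a prime factor \<open>p\<close> congruent to 3 modulo 4. Modulo \<open>p\<close> the number \<open>4d\<close> is 1, so the form satisfies
  \<open>4aQ = (2(ax + by))\<^sup>2 + y\<^sup>2\<close> and symmetrically \<open>4cQ = (2(bx + cy))\<^sup>2 + x\<^sup>2\<close>, and since \<open>-1\<close> is not a square modulo \<open>p\<close>, the form is anisotropic
  there. Hence every vector representing \<open>np\<^sup>2\<close> is \<open>p\<close> times a vector representing \<open>n\<close>.
\<close>

section \<open>Primes congruent to 3 modulo 4 and sums of two squares\<close>

lemma prime_factor_3_mod_4:
  fixes m :: nat
  assumes "m mod 4 = 3"
  shows "\<exists>p. prime p \<and> p dvd m \<and> p mod 4 = 3"
  using assms
proof (induction m rule: less_induct)
  case (less m)
  have "m \<noteq> 1" using less.prems by auto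
  then obtain q where q: "prime q" "q dvd m" using prime_factor_nat by blast
  then obtain r where r: "m = q * r" by auto
  show ?case
  proof (cases "q mod 4 = 3")
    case True
    with q show ?thesis by blast
  next
    case False
    \<comment> \<open>An even \<open>q\<close> would make the product even, so \<open>q\<close> is 1
      modulo 4 and the residue 3 passes to the smaller cofactor \<open>r\<close>.\<close>
    have "(q mod 4) * (r mod 4) mod 4 = 3"
      using less.prems r by (simp add: mod_mult_eq)
    moreover have "q mod 4 \<in> {0, 1, 2}" "r mod 4 \<in> {0, 1, 2, 3}" using False by auto
    ultimately have "r mod 4 = 3" by auto
    moreover have "r < m"
      using r less.prems prime_gt_1_nat[OF q(1)] by (cases "r = 0") auto
    ultimately obtain p where "prime p" "p dvd r" "p mod 4 = 3" using less.IH by blast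
    with r show ?thesis by auto
  qed
qed

text \<open>Otherwise \<open>x\<close> and \<open>y\<close> are both units modulo \<open>p\<close>.
  Raising \<open>x^2 = -y^2\<close> to the power \<open>h = (p - 1) / 2\<close>, which is odd as
  \<open>p\<close> is 3 modulo 4, keeps the sign, and Fermat turns the result into
  \<open>1 = -1\<close> modulo an odd prime.\<close>

lemma prime_3_mod_4_dvd_sum_two_squares:
  fixes x y :: int and p :: nat
  assumes "prime p" "p mod 4 = 3" and dvd: "int p dvd x\<^sup>2 + y\<^sup>2"
  shows "int p dvd x"
proof (rule ccontr)
  assume x: "\<not> int p dvd x"
  have ip: "prime (int p)" using assms(1) by simp
  have y: "\<not> int p dvd y"
  proof
    assume "int p dvd y"
    then have "int p dvd y\<^sup>2" by (simp add: power2_eq_square)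
    with dvd have "int p dvd x\<^sup>2" by (simp add: dvd_add_left_iff)
    with x ip show False using prime_dvd_power by blast
  qed
  define h where "h = (p - 1) div 2"
  have h: "p - 1 = 2 * h" and "odd h" using assms(2) unfolding h_def by presburger+
  have fermat: "[z ^ (2 * h) = 1] (mod int p)" if "\<not> int p dvd z" for z
  proof -
    have "coprime z (int p)" using that ip by (metis coprime_commute prime_imp_coprime)
    moreover have "residues (int p)" using prime_gt_1_int[OF ip] by (simp add: residues_def)
    ultimately have "[z ^ totient (nat (int p)) = 1] (mod int p)"
      by (rule residues.euler_theorem[rotated])
    then show ?thesis using h totient_prime[OF assms(1)] by simp
  qed
  have "[x\<^sup>2 = - (y\<^sup>2)] (mod int p)"
    using dvd by (simp add: cong_iff_dvd_diff)
  then have "[(x\<^sup>2) ^ h = (- (y\<^sup>2)) ^ h] (mod int p)" by (rule cong_pow)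
  then have "[x ^ (2 * h) = - (y ^ (2 * h))] (mod int p)"
    using \<open>odd h\<close> by (simp add: power_mult power_minus_odd)
  then have "[1 = - (1::int)] (mod int p)"
    using fermat[OF x] fermat[OF y] by (meson cong_minus_minus_iff cong_sym cong_trans)
  then have "int p dvd 2" by (simp add: cong_iff_dvd_diff)
  then have "p \<le> 2" using zdvd_imp_le by fastforce
  with assms(2) prime_gt_1_nat[OF assms(1)] show False by (cases "p = 2") auto
qed

section \<open>Binary forms modulo a prime factor of 4d - 1\<close>

lemma binary_form_anisotropic:
  fixes a b c x y :: int and p :: nat
  assumes p: "prime p" "p mod 4 = 3" "int p dvd 4 * (a * c - b\<^sup>2) - 1"
    and dvd: "int p dvd a * x\<^sup>2 + 2 * b * x * y + c * y\<^sup>2"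
  shows "int p dvd x \<and> int p dvd y"
proof -
  let ?f = "a * x\<^sup>2 + 2 * b * x * y + c * y\<^sup>2" and ?e = "4 * (a * c - b\<^sup>2) - 1"
  \<comment> \<open>Completing the square leaves \<open>4 * (a * c - b^2) * y^2\<close>, whose
    coefficient is \<open>?e + 1\<close>. The square of \<open>y\<close> stands first because the
    two-squares lemma concludes about the first summand.\<close>
  have "y\<^sup>2 + (2 * (a * x + b * y))\<^sup>2 = 4 * a * ?f - ?e * y\<^sup>2"
    by (simp add: power2_eq_square algebra_simps)
  also have "int p dvd \<dots>" by (rule dvd_diff[OF dvd_mult[OF dvd] dvd_mult2[OF p(3)]])
  finally have y: "int p dvd y" by (rule prime_3_mod_4_dvd_sum_two_squares[OF p(1,2)])
  \<comment> \<open>Exchanging the roles of the variables yields \<open>x\<close> without inverting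
    \<open>a\<close>, so the case that \<open>p\<close> divides \<open>a\<close> needs no separate
    treatment.\<close>
  have "x\<^sup>2 + (2 * (b * x + c * y))\<^sup>2 = 4 * c * ?f - ?e * x\<^sup>2"
    by (simp add: power2_eq_square algebra_simps)
  also have "int p dvd \<dots>" by (rule dvd_diff[OF dvd_mult[OF dvd] dvd_mult2[OF p(3)]])
  finally have "int p dvd x" by (rule prime_3_mod_4_dvd_sum_two_squares[OF p(1,2)])
  with y show ?thesis by blast
qed

text \<open>The prime \<open>p\<close> depends only on the discriminant, so \<open>k = p\<close> can
  be chosen before any vector is known. Cancelling \<open>p^2\<close> in the resulting
  representation is the descent.\<close>

lemma binary_form_descent:
  fixes a b c n :: int
  assumes d: "a * c - b\<^sup>2 > 0"
    and rep: "\<And>k. k \<ge> 2 \<Longrightarrow> \<exists>x y. a * x\<^sup>2 + 2 * b * x * y + c * y\<^sup>2 = n * k\<^sup>2"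
  shows "\<exists>x y. a * x\<^sup>2 + 2 * b * x * y + c * y\<^sup>2 = n"
proof -
  \<comment> \<open>Since the discriminant is at least 1, \<open>e\<close> is at least 3, and
    passing to \<open>nat\<close> preserves its residue and divisors.\<close>
  define e where "e = 4 * (a * c - b\<^sup>2) - 1"
  have "e > 0" "e mod 4 = 3" using d unfolding e_def by presburger+
  then have "nat e mod 4 = 3" by (simp add: nat_mod_distrib[of e 4, symmetric] flip: nat_numeral)
  then obtain p where p: "prime p" "p dvd nat e" "p mod 4 = 3"
    using prime_factor_3_mod_4 by blast
  have pe: "int p dvd e" using p(2) \<open>e > 0\<close> by (simp add: int_dvd_int_iff[symmetric])
  have "int p \<ge> 2" using prime_ge_2_nat[OF p(1)] by simp
  then obtain x y where xy: "a * x\<^sup>2 + 2 * b * x * y + c * y\<^sup>2 = n * (int p)\<^sup>2" using rep by blast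
  then have "int p dvd a * x\<^sup>2 + 2 * b * x * y + c * y\<^sup>2" by (simp add: power2_eq_square)
  then have "int p dvd x" "int p dvd y"
    using binary_form_anisotropic[OF p(1,3) pe[unfolded e_def]] by blast+
  then obtain x' y' where "x = int p * x'" "y = int p * y'" by (auto elim!: dvdE)
  with xy have "(int p)\<^sup>2 * (a * x'\<^sup>2 + 2 * b * x' * y' + c * y'\<^sup>2) = (int p)\<^sup>2 * n"
    by (simp add: power2_eq_square algebra_simps)
  with \<open>int p \<ge> 2\<close> have "a * x'\<^sup>2 + 2 * b * x' * y' + c * y'\<^sup>2 = n" by simp
  then show ?thesis by blast
qed

section \<open>Gram matrices of integral binary lattices\<close>

lemma binary_zlattice_gram:
  fixes L :: "'a::ab_group_add zlat"
  assumes "zlattice L" "has_rank L 2" "scale_ideal L \<subseteq> \<int>"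
  obtains a b c :: int where "a * c - b\<^sup>2 > 0"
    and "\<forall>m. represents_int L m \<longleftrightarrow> (\<exists>x y. a * x\<^sup>2 + 2 * b * x * y + c * y\<^sup>2 = m)"
proof -
  obtain B :: "'a set" where "finite B" "card B = 2" and indep: "int_module.independent B"
    and span: "int_module.span B = points L"
    using assms(2) unfolding has_rank_def by blast
  then obtain u v where B: "B = {u, v}" and "u \<noteq> v" by (auto simp: card_2_iff)
  have mem: "int_scale x u + int_scale y v \<in> points L" for x y
    unfolding span[symmetric] B
    by (intro int_module.span_add int_module.span_scale int_module.span_base) auto
  have points: "\<exists>x y. z = int_scale x u + int_scale y v" if "z \<in> points L" for z
  proof -
    have "z \<in> int_module.span {u, v}" using that span B by simp
    then obtain x where "z - int_scale x u \<in> int_module.span {v}"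
      unfolding int_module.span_breakdown_eq by blast
    then obtain y where "z - int_scale x u = int_scale y v"
      by (auto simp: int_module.span_singleton)
    then have "z = int_scale x u + int_scale y v" by (simp add: algebra_simps)
    then show ?thesis by blast
  qed
  have uv: "u \<in> points L" "v \<in> points L"
    unfolding span[symmetric] B by (auto intro: int_module.span_base)
  have xuv: "int_scale x u \<in> points L" "int_scale x v \<in> points L" for x
    using mem[of x 0] mem[of 0 x] by simp_all
  have integral: "form L z w \<in> \<int>" if "z \<in> points L" "w \<in> points L" for z w
    using assms(3) that unfolding scale_ideal_def by (blast intro: int_module.span_base)
  obtain a where a: "form L u u = of_int a" using integral[OF uv(1) uv(1)] Ints_cases by blast
  obtain b where b: "form L u v = of_int b" using integral[OF uv] Ints_cases by blast
  obtain c where c: "form L v v = of_int c" using integral[OF uv(2) uv(2)] Ints_cases by blast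
  have b': "form L v u = of_int b"
    using assms(1) uv b unfolding zlattice_def symmetric_form_def by metis
  have add: "form L (z + w) t = form L z t + form L w t" "form L t (z + w) = form L t z + form L t w"
    if "z \<in> points L" "w \<in> points L" "t \<in> points L" for z w t
    using assms(1) that unfolding zlattice_def bilinear_form_def by blast+
  have scale: "form L (int_scale k z) t = of_int k * form L z t"
    "form L t (int_scale k z) = of_int k * form L t z"
    if "z \<in> points L" "t \<in> points L" for k z t
    using assms(1) that unfolding zlattice_def bilinear_form_def by blast+
  have q: "qform L (int_scale x u + int_scale y v) = of_int (a * x\<^sup>2 + 2 * b * x * y + c * y\<^sup>2)" for x y
    by (simp add: add scale mem xuv uv a b b' c power2_eq_square algebra_simps)
  have pos: "a * x\<^sup>2 + 2 * b * x * y + c * y\<^sup>2 > 0" if "x \<noteq> 0 \<or> y \<noteq> 0" for x y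
  proof -
    \<comment> \<open>Positive definiteness speaks of nonzero vectors; independence of the basis
      turns a nonzero coordinate pair into one.\<close>
    have "int_scale x u + int_scale y v \<noteq> 0"
    proof
      assume 0: "int_scale x u + int_scale y v = 0"
      have "int_module.dependent B"
        unfolding int_module.dependent_finite[OF \<open>finite B\<close>]
        by (rule exI[of _ "\<lambda>z. if z = u then x else y"]) (use that 0 \<open>u \<noteq> v\<close> B in auto)
      with indep show False by simp
    qed
    then have "qform L (int_scale x u + int_scale y v) > 0"
      using assms(1) mem unfolding zlattice_def positive_definite_def by blast
    then show ?thesis unfolding q of_int_0_less_iff .
  qed
  have "a > 0" using pos[of 1 0] by simp
  \<comment> \<open>The vector \<open>b u - a v\<close> is orthogonal to \<open>u\<close>, and its
    norm is \<open>a\<close> times the discriminant.\<close>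
  moreover have "a * (a * c - b\<^sup>2) > 0"
    using pos[of b "- a"] \<open>a > 0\<close> by (simp add: power2_eq_square algebra_simps)
  ultimately have "a * c - b\<^sup>2 > 0" by (simp add: zero_less_mult_iff)
  moreover have "represents_int L m \<longleftrightarrow> (\<exists>x y. a * x\<^sup>2 + 2 * b * x * y + c * y\<^sup>2 = m)" for m
  proof
    assume "represents_int L m"
    then obtain z where "z \<in> points L" "qform L z = of_int m" unfolding represents_int_def by blast
    then show "\<exists>x y. a * x\<^sup>2 + 2 * b * x * y + c * y\<^sup>2 = m"
      using points q by (metis of_int_eq_iff)
  next
    assume "\<exists>x y. a * x\<^sup>2 + 2 * b * x * y + c * y\<^sup>2 = m"
    then show "represents_int L m" using q mem unfolding represents_int_def by metis
  qed
  ultimately show ?thesis using that by blast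
qed

text \<open>Carries the descent from forms to lattices; both halves of the theorem rest on
  it.\<close>

lemma binary_represents_int:
  fixes L :: "'a::ab_group_add zlat"
  assumes "zlattice L" "has_rank L 2" "scale_ideal L \<subseteq> \<int>"
    and rep: "\<And>k::int. k \<ge> 2 \<Longrightarrow> represents_int L (n * k\<^sup>2)"
  shows "represents_int L n"
proof -
  obtain a b c :: int where d: "a * c - b\<^sup>2 > 0"
    and gram: "\<forall>m. represents_int L m \<longleftrightarrow> (\<exists>x y. a * x\<^sup>2 + 2 * b * x * y + c * y\<^sup>2 = m)"
    by (rule binary_zlattice_gram[OF assms(1-3)]) (rule that)
  have "\<exists>x y. a * x\<^sup>2 + 2 * b * x * y + c * y\<^sup>2 = n * k\<^sup>2" if "k \<ge> 2" for k
    by (rule iffD1[OF gram[rule_format] rep[OF that]])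
  with d have "\<exists>x y. a * x\<^sup>2 + 2 * b * x * y + c * y\<^sup>2 = n" by (rule binary_form_descent)
  then show ?thesis by (rule iffD2[OF gram[rule_format]])
qed

section \<open>The sublattices kZ of the unary lattice, isometric to the lattices with Gram matrix
  \<open>n * k^2\<close>\<close>

definition unary_multiple :: "int \<Rightarrow> int \<Rightarrow> int zlat" where
  "unary_multiple n k = (unary n)\<lparr>points := range ((*) k)\<rparr>"

lemma has_rank_unary_multiple:
  assumes "k \<noteq> 0"
  shows "has_rank (unary_multiple n k) 1"
  unfolding has_rank_def
proof (intro exI conjI)
  show "int_module.independent {k}"
    using assms by (auto simp: int_module.dependent_finite int_scale_ring)
  show "int_module.span {k} = points (unary_multiple n k)"
    by (auto simp: unary_multiple_def int_module.span_singleton int_scale_ring mult.commute)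
qed simp_all

lemma lattice_index_unary_multiple:
  assumes "k \<ge> 2"
  shows "lattice_index (unary n) (unary_multiple n k) > 1"
proof -
  define C where "C x = (+) x ` range ((*) k)" for x :: int
  have mem: "z \<in> C x \<longleftrightarrow> z mod k = x mod k" for z x
    unfolding C_def mod_eq_dvd_iff by (auto simp: dvd_def image_iff algebra_simps)
  \<comment> \<open>Finiteness has to come first: \<open>card\<close> is 0 on infinite sets, so two
    distinct cosets alone would not bound the index below.\<close>
  have "range C \<subseteq> C ` {0..<k}"
  proof
    fix X assume "X \<in> range C"
    then obtain x where "X = C x" by blast
    also have "C x = C (x mod k)"
      by (auto simp: mem)
    finally show "X \<in> C ` {0..<k}" using assms by simp
  qed
  then have fin: "finite (range C)" by (rule finite_subset) simp
  have "1 \<in> C 1" "1 \<notin> C 0" using assms by (auto simp: mem)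
  then have "C 0 \<noteq> C 1" by blast
  then have "card {C 0, C 1} = 2" by simp
  moreover have "card {C 0, C 1} \<le> card (range C)" by (rule card_mono[OF fin]) auto
  moreover have "{(+) x ` points (unary_multiple n k) |x. x \<in> points (unary n)} = range C"
    by (auto simp: C_def unary_multiple_def unary_def)
  ultimately show ?thesis unfolding lattice_index_def by simp
qed

text \<open>Keeping the ambient form and shrinking only the point set lets bilinearity, symmetry and
  positivity be inherited by restriction.\<close>

lemma proper_sublattice_unary_multiple:
  assumes "n > 0" "k \<ge> 2"
  shows "proper_sublattice (unary_multiple n k) (unary n)"
proof -
  have rank: "has_rank (unary_multiple n k) 1" using assms has_rank_unary_multiple[of k n] by linarith
  have "zlattice (unary_multiple n k)"
    using zlattice_unary[OF assms(1)] rank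
    unfolding zlattice_def bilinear_form_def symmetric_form_def positive_definite_def
    by (auto simp: unary_multiple_def unary_def)
  then have "sublattice (unary_multiple n k) (unary n)"
    unfolding sublattice_def by (simp add: unary_multiple_def unary_def)
  with rank has_rank_unary lattice_index_unary_multiple[OF assms(2)] show ?thesis
    unfolding proper_sublattice_def by blast
qed

text \<open>A representation of a rank one lattice is determined by the image of the generator 1.
  Conversely, a vector \<open>z\<close> of norm \<open>n\<close> gives the map sending
  \<open>k\<close> to \<open>k z\<close>.\<close>

lemma represents_unary_iff:
  assumes "zlattice L"
  shows "represents L (unary n) \<longleftrightarrow> represents_int L n"
proof
  assume "represents L (unary n)"
  moreover have "1 \<in> points (unary n)" by (simp add: unary_def)
  ultimately obtain z where "z \<in> points L" "qform L z = form (unary n) 1 1"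
    unfolding represents_def by blast
  then show "represents_int L n" unfolding represents_int_def by (auto simp: unary_def)
next
  assume "represents_int L n"
  then obtain z where z: "z \<in> points L" "qform L z = of_int n" unfolding represents_int_def by blast
  obtain B where span: "int_module.span B = points L"
    using assms unfolding zlattice_def has_rank_def by blast
  have mem: "int_scale k z \<in> points L" for k
    using z(1) unfolding span[symmetric] by (rule int_module.span_scale)
  have scale: "form L (int_scale k x) t = of_int k * form L x t"
    "form L t (int_scale k x) = of_int k * form L t x"
    if "x \<in> points L" "t \<in> points L" for k x t
    using assms that unfolding zlattice_def bilinear_form_def by blast+
  show "represents L (unary n)"
    unfolding represents_def
    by (rule exI[of _ "\<lambda>k. int_scale k z"])
      (simp add: unary_def mem scale z int_module.scale_left_distrib int_scale_ring)
qed

text \<open>The generator \<open>k\<close> has norm \<open>n * k^2\<close>, and so has its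
  image.\<close>

lemma represents_unary_multiple:
  assumes "represents L (unary_multiple n k)"
  shows "represents_int L (n * k\<^sup>2)"
proof -
  have "k \<in> points (unary_multiple n k)" by (auto simp: unary_multiple_def image_iff intro: exI[of _ 1])
  then obtain z where "z \<in> points L" "qform L z = form (unary_multiple n k) k k"
    using assms unfolding represents_def by blast
  then show ?thesis
    unfolding represents_int_def
    by (auto simp: unary_multiple_def unary_def power2_eq_square mult.assoc)
qed

theorem theorem2p4:
  fixes n :: int
  assumes "n > 0"
  shows "(\<nexists>L :: 'a::ab_group_add zlat. has_rank L 2 \<and> isolation L (unary n)) \<and>
         (\<nexists>L :: 'a zlat. zlattice L \<and> has_rank L 2 \<and> scale_ideal L \<subseteq> \<int> \<and>
            (\<forall>k::int. k \<ge> 2 \<longrightarrow> represents_int L (n * k ^ 2)) \<and> \<not> represents_int L n)"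
proof (intro conjI notI; elim exE conjE)
  fix L :: "'a zlat"
  assume rank: "has_rank L 2" and iso: "isolation L (unary n)"
  have L: "zlattice L" "scale_ideal L \<subseteq> \<int>" and "\<not> represents L (unary n)"
    and sub: "\<And>K. proper_sublattice K (unary n) \<Longrightarrow> represents L K"
    using iso unfolding isolation_def by blast+
  \<comment> \<open>For \<open>k \<ge> 2\<close> the isolation represents the proper sublattice kZ,
    hence the integer \<open>n * k^2\<close>, which is what the descent needs.\<close>
  moreover have "represents_int L n"
    using binary_represents_int[OF L(1) rank L(2)] assms sub
      proper_sublattice_unary_multiple represents_unary_multiple by blast
  ultimately show False using represents_unary_iff by blast
next
  fix L :: "'a zlat"
  assume "zlattice L" "has_rank L 2" "scale_ideal L \<subseteq> \<int>"
    "\<forall>k::int. k \<ge> 2 \<longrightarrow> represents_int L (n * k ^ 2)" "\<not> represents_int L n"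
  then show False using binary_represents_int by blast
qed

end
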